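(* Let $m\ge 2$ be an integer, $\kappa=e^{i\pi/m}$, $\lambda\in\mathbb{C}$, and let $\nu=(\nu_1,\dots,\nu_{m-1})$. Under the condition $$k_j=m\nu_j+m-j\ge 0,\qquad j=1,\dots,m-1,$$ the system $$T(k)f(x)=\kappa\lambda f(x),\qquad f(0)=1,$$ where $T(k)$ is the complex Dunkl operator with parameters $k_1,\dots,k_{m-1}$ (defined in the context), has the following solution: $$\mathcal{D}_\nu(\lambda,x)=\mathcal{J}_{\nu}(\lambda x)+\sum_{j=1}^{m-1}\frac{(\kappa\lambda)^j}{m^j(\nu_1+1)\cdots(\nu_{m-j}+1)}\,\mathcal{J}_{(\nu_1+1,\dots,\nu_j+1,\nu_{j+1},\dots,\nu_{m-1})}(\lambda x).$$
   Context: Let $\varepsilon=e^{2i\pi/m}$ and $U=\bigcup_{j=1}^m\varepsilon^j\mathbb{R}\subset\mathbb{C}$, a set of radial rays in the complex plane. The complex Dunkl operator with parameters $k=(k_1,\dots,k_{m-1},0)$ acts on $C^\infty$ complex-valued functions $f$ on $U$ by $$T(k)f(x)=\frac{df(x)}{dx}+\sum_{i=1}^{m-1}\frac{k_i}{x}\sum_{j=0}^{m-1}\varepsilon^{-ij}f(\varepsilon^jx).$$ For a vector index $\mu=(\mu_1,\dots,\mu_{m-1})\in\mathbb{R}^{m-1}$ with $\mu_k\ge -1+\frac{k}{m}$ for $1\le k\le m-1$, the function $\mathcal{J}_\mu=\mathcal{J}_{\mu,m}$ is the normalized hyper-Bessel function $$\mathcal{J}_{\mu,m}(x)=\sum_{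n=0}^\infty\frac{(-1)^n\prod_{j=1}^{m-1}\Gamma(\mu_j+1)}{n!\,\prod_{j=1}^{m-1}\Gamma(\mu_j+n+1)}\left(\frac{x}{m}\right)^{nm}.$$
   Formalization: The printed formula is false (its value at x=0 is not 1); corrected: the prefactor is (κλx)^j instead of (κλ)^j, the denominator product is (ν_1+1)…(ν_j+1) instead of up to ν_{m-j}+1, and the condition reads m k_j = mν_j+m-j with k_j ≥ 0. *)

theory Defs
  imports "HOL-Analysis.Analysis"
begin

definition root_eps :: "nat \<Rightarrow> complex" where
  "root_eps m = exp (2 * \<i> * of_real pi / of_nat m)"

definition rays :: "nat \<Rightarrow> complex set" where
  "rays m = (\<Union>j\<in>{1..m}. {root_eps m ^ j * of_real r | r :: real. True})"

text \<open>
  A function on the set of rays is represented by a total function whose values outside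
  \<open>rays m\<close> are irrelevant.  The derivative \<open>df/dx\<close> is the limit of difference quotients
  taken within \<open>rays m\<close>; it is unique because \<open>rays m\<close> has no isolated points.
\<close>

definition ray_deriv :: "nat \<Rightarrow> (complex \<Rightarrow> complex) \<Rightarrow> complex \<Rightarrow> complex" where
  "ray_deriv m f x = (THE D. (f has_field_derivative D) (at x within rays m))"

definition smooth_on_rays :: "nat \<Rightarrow> (complex \<Rightarrow> complex) \<Rightarrow> bool" where
  "smooth_on_rays m f \<longleftrightarrow>
     (\<forall>n. \<forall>x\<in>rays m. ((ray_deriv m ^^ n) f) field_differentiable (at x within rays m))"

definition dunkl_formula ::
    "nat \<Rightarrow> (nat \<Rightarrow> real) \<Rightarrow> (complex \<Rightarrow> complex) \<Rightarrow> complex \<Rightarrow> complex" where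
  "dunkl_formula m k f x =
     ray_deriv m f x +
     (\<Sum>i=1..m-1. of_real (k i) / x *
        (\<Sum>j=0..m-1. root_eps m powi (- (int i * int j)) * f (root_eps m ^ j * x)))"

text \<open>
  The formula has a removable singularity at \<open>0\<close> when \<open>f\<close> is smooth on the rays (for
  \<open>0 < i < m\<close> the inner sum vanishes at \<open>0\<close>), so the value there is the continuous
  extension.  Evaluating the formula itself at \<open>0\<close> would be wrong, since \<open>k / 0 = 0\<close>
  would simply discard the difference part.
\<close>

definition complex_dunkl ::
    "nat \<Rightarrow> (nat \<Rightarrow> real) \<Rightarrow> (complex \<Rightarrow> complex) \<Rightarrow> complex \<Rightarrow> complex" where
  "complex_dunkl m k f x =
     (if x = 0 then Lim (at 0 within rays m) (dunkl_formula m k f)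
      else dunkl_formula m k f x)"

definition hyper_bessel :: "nat \<Rightarrow> (nat \<Rightarrow> real) \<Rightarrow> complex \<Rightarrow> complex" where
  "hyper_bessel m \<mu> x =
     (\<Sum>n. of_real ((-1) ^ n * (\<Prod>j=1..m-1. Gamma (\<mu> j + 1)) /
                 (fact n * (\<Prod>j=1..m-1. Gamma (\<mu> j + real n + 1)))) *
          (x / of_nat m) ^ (n * m))"

definition raise_first :: "nat \<Rightarrow> (nat \<Rightarrow> real) \<Rightarrow> nat \<Rightarrow> real" where
  "raise_first j \<nu> i = (if i \<le> j then \<nu> i + 1 else \<nu> i)"

definition dunkl_kappa :: "nat \<Rightarrow> complex" where
  "dunkl_kappa m = exp (\<i> * of_real pi / of_nat m)"

text \<open>
  On monomials, \<open>T (x ^ n) = (n + m * k (n mod m)) * x ^ (n - 1)\<close> with \<open>k 0 = 0\<close>,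
  the factor \<open>m\<close> coming from the sum over the \<open>m\<close>-th roots of unity.  A solution of
  \<open>T f = c f\<close>, \<open>f 0 = 1\<close> is therefore matched to Bessel indices by
  \<open>m * k j = m * \<nu> j + m - j\<close>.  The \<open>j\<close>-th term below collects the powers
  \<open>x ^ (n * m + j)\<close>: it has to contain \<open>x ^ j\<close>, and its denominator is the product of the
  eigenvalue factors \<open>i + m * k i = m * (\<nu> i + 1)\<close> for \<open>1 \<le> i \<le> j\<close>.  (The variant
  without \<open>x ^ j\<close>, with the product running up to \<open>m - j\<close> and with \<open>k j\<close> in
  place of \<open>m * k j\<close> is not a solution: its value at \<open>0\<close> is not even \<open>1\<close>.)
\<close>

definition dunkl_kernel :: "nat \<Rightarrow> (nat \<Rightarrow> real) \<Rightarrow> complex \<Rightarrow> complex \<Rightarrow> complex" where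
  "dunkl_kernel m \<nu> lam x =
     hyper_bessel m \<nu> (lam * x) +
     (\<Sum>j=1..m-1. (dunkl_kappa m * lam * x) ^ j /
                  (of_nat m ^ j * (\<Prod>i=1..j. of_real (\<nu> i + 1))) *
                  hyper_bessel m (raise_first j \<nu>) (lam * x))"

end

theory Submission
  imports Defs "HOL-Complex_Analysis.Cauchy_Integral_Formula"
begin

text \<open>
  On monomials the Dunkl operator is a weighted shift: \<open>T x\<^sup>n = w n * x\<^sup>n\<^sup>-\<^sup>1\<close> with
  \<open>w n = n + m * k (n mod m)\<close> (and no second summand when \<open>m\<close> divides \<open>n\<close>), because the inner sum
  over the \<open>m\<close>-th roots of unity filters out the exponents congruent to \<open>i\<close>.  Hence the power series
  \<open>E z = (\<Sum>n. z\<^sup>n / (w 1 * \<dots> * w n))\<close>, the analogue of the exponential function for these weights,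
  satisfies \<open>T (E (c x)) = c E (c x)\<close> and \<open>E 0 = 1\<close> for every \<open>c\<close>.  Since \<open>k \<ge> 0\<close> gives
  \<open>w n \<ge> n\<close>, the series is dominated by the exponential series, so \<open>E\<close> is entire.  An entire function
  is smooth on the rays, and its ray derivatives are the complex ones
  (\<open>smooth_on_rays_holomorphic\<close>); the action on a power series is \<open>dunkl_formula_power_series\<close>.

  It remains to see that the Bessel combination is \<open>E (\<kappa> \<lambda> x)\<close>.  The relation between \<open>k\<close> and \<open>\<nu>\<close>
  says \<open>w (n m + i) = m (\<nu>\<^sub>i + 1 + n)\<close> for \<open>0 < i < m\<close>, so the products of the weights
  are products of Pochhammer symbols, that is, of Gamma quotients.  Splitting \<open>E\<close> into the
  \<open>m\<close> subseries of exponents congruent to \<open>j\<close> modulo \<open>m\<close> then yields one hyper-Bessel function for each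
  \<open>j\<close>: passing from \<open>0\<close> to \<open>j\<close> supplies one additional factor to the first \<open>j\<close> Pochhammer symbols,
  which is the shift of the first \<open>j\<close> indices, and \<open>\<kappa>\<^sup>m = -1\<close> produces the alternating signs
  (\<open>dunkl_kernel_eq_dunkl_exp\<close>).
\<close>

section \<open>Roots of unity\<close>

lemma root_eps_power: "root_eps m ^ n = exp (2 * of_real pi * \<i> * of_nat n / of_nat m)"
  by (simp add: root_eps_def exp_of_nat_mult[symmetric] field_simps)

lemma root_eps_power_m: "m > 0 \<Longrightarrow> root_eps m ^ m = 1"
  by (simp add: root_eps_power exp_eq_1)

lemma root_eps_power_eq_iff:
  assumes "m > 0"
  shows "root_eps m ^ a = root_eps m ^ b \<longleftrightarrow> a mod m = b mod m"
  using complex_root_unity_eq[of m a b] assms by (simp add: root_eps_power)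

lemma root_eps_nonzero [simp]: "root_eps m \<noteq> 0"
  by (simp add: root_eps_def)

text \<open>
  The summand is the \<open>j\<close>-th power of \<open>\<epsilon>\<^sup>n\<^sup>-\<^sup>i\<close>, an \<open>m\<close>-th root of unity, so the sum is a geometric
  series that vanishes unless this root is \<open>1\<close>.
\<close>
lemma root_of_unity_filter:
  assumes "i < m"
  shows "(\<Sum>j=0..m-1. root_eps m powi (- (int i * int j)) * (root_eps m ^ j) ^ n)
           = (if n mod m = i then of_nat m else 0)"
proof -
  define q where "q = root_eps m ^ n / root_eps m ^ i"
  have m: "m > 0" using assms by simp
  have "root_eps m powi (- (int i * int j)) * (root_eps m ^ j) ^ n = q ^ j" for j
  proof -
    have "root_eps m powi (- (int i * int j)) = inverse ((root_eps m ^ i) ^ j)"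
      by (metis of_nat_mult power_int_minus power_int_of_nat power_mult)
    moreover have "(root_eps m ^ j) ^ n = (root_eps m ^ n) ^ j"
      by (metis mult.commute power_mult)
    ultimately show ?thesis
      by (simp add: q_def power_divide field_simps)
  qed
  moreover have "{0..m-1} = {..<m}" using m by auto
  ultimately have sum: "(\<Sum>j=0..m-1. root_eps m powi (- (int i * int j)) * (root_eps m ^ j) ^ n)
      = (\<Sum>j<m. q ^ j)"
    by simp
  have "q ^ m = (root_eps m ^ m) ^ n / (root_eps m ^ m) ^ i"
    unfolding q_def power_divide by (metis mult.commute power_mult)
  then have qm: "q ^ m = 1" using m by (simp add: root_eps_power_m)
  have q1: "q = 1 \<longleftrightarrow> n mod m = i"
    using root_eps_power_eq_iff[OF m, of n i] assms by (simp add: q_def)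
  show ?thesis
  proof (cases "q = 1")
    case True
    then show ?thesis using sum q1 by simp
  next
    case False
    then show ?thesis using sum q1 qm geometric_sum[OF False, of m] by simp
  qed
qed

section \<open>Derivatives along the rays\<close>

lemma zero_in_rays: "m > 0 \<Longrightarrow> 0 \<in> rays m"
  unfolding rays_def by (simp add: Bex_def) (metis One_nat_def Suc_leI order_refl)

lemma islimpt_rays:
  assumes "x \<in> rays m"
  shows "x islimpt rays m"
  unfolding islimpt_approachable
proof (intro allI impI)
  fix e :: real assume e: "e > 0"
  obtain j r where j: "j \<in> {1..m}" and x: "x = root_eps m ^ j * of_real r"
    using assms unfolding rays_def by auto
  define y where "y = root_eps m ^ j * of_real (r + e / 2)"
  have "y \<in> rays m" using j unfolding rays_def y_def by blast
  moreover have yx: "y - x = root_eps m ^ j * of_real (e / 2)"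
    by (simp add: y_def x algebra_simps)
  have "norm (root_eps m) = 1" by (simp add: root_eps_def)
  then have "dist y x = e / 2" using e
    unfolding dist_norm yx by (simp add: norm_mult norm_power)
  ultimately show "\<exists>x'\<in>rays m. x' \<noteq> x \<and> dist x' x < e"
    using e by (intro bexI[of _ y]) auto
qed

lemma ray_deriv_eqI:
  assumes "x \<in> rays m" "(f has_field_derivative D) (at x within rays m)"
  shows "ray_deriv m f x = D"
  unfolding ray_deriv_def
proof (rule the_equality)
  show "(f has_field_derivative D) (at x within rays m)" by fact
next
  fix D' assume "(f has_field_derivative D') (at x within rays m)"
  then show "D' = D"
    using assms islimpt_rays[OF assms(1)] unfolding has_field_derivative_iff
    by (metis tendsto_unique trivial_limit_within)
qed

text \<open>
  Off the rays the iterated ray derivative is unspecified, so the two derivatives are only compared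
  on the rays; this suffices, since derivatives within the rays see no other points.
\<close>
lemma iterated_ray_deriv_holomorphic:
  assumes "f holomorphic_on UNIV" "x \<in> rays m"
  shows "((ray_deriv m ^^ n) f has_field_derivative (deriv ^^ Suc n) f x) (at x within rays m)
       \<and> (ray_deriv m ^^ n) f x = (deriv ^^ n) f x"
  using assms(2)
proof (induction n arbitrary: x)
  case 0
  then show ?case
    using holomorphic_derivI[OF assms(1), of x "rays m"] by simp
next
  case (Suc n)
  have eq: "(ray_deriv m ^^ Suc n) f y = (deriv ^^ Suc n) f y" if "y \<in> rays m" for y
    using ray_deriv_eqI[OF that conjunct1[OF Suc.IH[OF that]]] by simp
  have "(deriv ^^ Suc n) f holomorphic_on UNIV"
    using assms(1) by (rule holomorphic_higher_deriv) simp
  then have "((deriv ^^ Suc n) f has_field_derivative (deriv ^^ Suc (Suc n)) f x)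
      (at x within rays m)"
    using holomorphic_derivI[of "(deriv ^^ Suc n) f" UNIV x "rays m"] by simp
  then have "((ray_deriv m ^^ Suc n) f has_field_derivative (deriv ^^ Suc (Suc n)) f x)
      (at x within rays m)"
    by (rule has_field_derivative_transform_within[where d = 1]) (use Suc.prems eq in auto)
  then show ?case using eq[OF Suc.prems] by blast
qed

lemma smooth_on_rays_holomorphic:
  "f holomorphic_on UNIV \<Longrightarrow> smooth_on_rays m f"
  unfolding smooth_on_rays_def field_differentiable_def
  using iterated_ray_deriv_holomorphic by blast

section \<open>The Dunkl operator on power series\<close>

text \<open>
  The factor by which the operator multiplies a monomial: differentiation contributes \<open>n\<close>, and only
  the summand \<open>i = n mod m\<close> of the difference part survives the filter.
\<close>
definition dunkl_weight :: "nat \<Rightarrow> (nat \<Rightarrow> real) \<Rightarrow> nat \<Rightarrow> real" where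
  "dunkl_weight m k n = real n + (if m dvd n then 0 else real m * k (n mod m))"

text \<open>
  Multiplying by \<open>x\<close> turns the weighted shift into the diagonal action
  \<open>x\<^sup>n \<mapsto> w n * x\<^sup>n\<close>, which needs no reindexing.
\<close>
lemma dunkl_formula_power_series:
  fixes a :: "nat \<Rightarrow> complex"
  assumes m: "m > 0" and conv: "\<And>y. (\<lambda>n. a n * y ^ n) sums f y"
    and x: "x \<in> rays m" "x \<noteq> 0"
  shows "(\<lambda>n. of_real (dunkl_weight m k n) * a n * x ^ n) sums (x * dunkl_formula m k f x)"
proof -
  have summ: "summable (\<lambda>n. a n * y ^ n)" for y using conv by (rule sums_summable)
  have f: "f = (\<lambda>y. \<Sum>n. a n * y ^ n)" using conv by (auto simp: sums_iff)
  have "(f has_field_derivative (\<Sum>n. diffs a n * x ^ n)) (at x)"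
    unfolding f by (rule termdiffs_strong_converges_everywhere[OF summ])
  then have "ray_deriv m f x = (\<Sum>n. diffs a n * x ^ n)"
    using ray_deriv_eqI[OF x(1)] has_field_derivative_at_within by blast
  then have "(\<lambda>n. diffs a n * x ^ n) sums ray_deriv m f x"
    using termdiff_converges_all[OF summ] by (simp add: summable_sums)
  then have "(\<lambda>n. x * (diffs a n * x ^ n)) sums (x * ray_deriv m f x)" by (rule sums_mult)
  then have "(\<lambda>n. of_nat (Suc n) * a (Suc n) * x ^ Suc n) sums (x * ray_deriv m f x)"
    by (simp add: diffs_def mult_ac)
  then have deriv: "(\<lambda>n. of_nat n * a n * x ^ n) sums (x * ray_deriv m f x)"
    using sums_Suc_iff[of "\<lambda>n. of_nat n * a n * x ^ n" "x * ray_deriv m f x"] by simp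
  define S where "S i = (\<Sum>j=0..m-1. root_eps m powi (- (int i * int j)) * f (root_eps m ^ j * x))"
    for i
  have S: "(\<lambda>n. (if n mod m = i then of_nat m else 0) * (a n * x ^ n)) sums S i"
    if "i \<in> {1..m-1}" for i
  proof -
    have "i < m" using that by auto
    have "(\<lambda>n. \<Sum>j=0..m-1. root_eps m powi (- (int i * int j)) * (a n * (root_eps m ^ j * x) ^ n))
        sums S i"
      unfolding S_def by (intro sums_sum sums_mult conv)
    moreover have "(\<Sum>j=0..m-1. root_eps m powi (- (int i * int j)) * (a n * (root_eps m ^ j * x) ^ n))
        = (if n mod m = i then of_nat m else 0) * (a n * x ^ n)" for n
      unfolding root_of_unity_filter[OF \<open>i < m\<close>, of n, symmetric] sum_distrib_right
      by (intro sum.cong refl) (simp add: power_mult_distrib)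
    ultimately show ?thesis by simp
  qed
  have "(\<lambda>n. \<Sum>i=1..m-1. of_real (k i) * ((if n mod m = i then of_nat m else 0) * (a n * x ^ n)))
      sums (\<Sum>i=1..m-1. of_real (k i) * S i)"
    by (intro sums_sum sums_mult S)
  moreover have "(\<Sum>i=1..m-1. of_real (k i) * ((if n mod m = i then of_nat m else 0) * (a n * x ^ n)))
      = of_real (if m dvd n then 0 else real m * k (n mod m)) * (a n * x ^ n)" for n
  proof -
    have "(\<Sum>i=1..m-1. of_real (k i) * ((if n mod m = i then of_nat m else 0) * (a n * x ^ n)))
        = (\<Sum>i=1..m-1. if n mod m = i then of_real (real m * k i) * (a n * x ^ n) else 0)"
      by (intro sum.cong) auto
    also have "\<dots> = (if n mod m \<in> {1..m-1} then of_real (real m * k (n mod m)) * (a n * x ^ n) else 0)"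
      by (rule sum.delta') simp
    also have "n mod m \<in> {1..m-1} \<longleftrightarrow> \<not> m dvd n"
      using m mod_less_divisor[OF m, of n] by (auto simp: dvd_eq_mod_eq_0)
    finally show ?thesis by simp
  qed
  ultimately have "(\<lambda>n. of_real (if m dvd n then 0 else real m * k (n mod m)) * (a n * x ^ n))
      sums (\<Sum>i=1..m-1. of_real (k i) * S i)"
    by simp
  from sums_add[OF deriv this]
  have "(\<lambda>n. of_real (dunkl_weight m k n) * a n * x ^ n) sums
      (x * ray_deriv m f x + (\<Sum>i=1..m-1. of_real (k i) * S i))"
    by (simp add: dunkl_weight_def algebra_simps)
  also have "x * ray_deriv m f x + (\<Sum>i=1..m-1. of_real (k i) * S i) = x * dunkl_formula m k f x"
    using x(2) by (simp add: dunkl_formula_def S_def distrib_left sum_distrib_left)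
  finally show ?thesis .
qed

section \<open>The Dunkl exponential\<close>

text \<open>
  The exponential series with \<open>n!\<close> replaced by the product of the weights; \<open>k = 0\<close> gives \<open>exp\<close>.
\<close>
definition dunkl_exp :: "nat \<Rightarrow> (nat \<Rightarrow> real) \<Rightarrow> complex \<Rightarrow> complex" where
  "dunkl_exp m k z = (\<Sum>n. z ^ n / of_real (\<Prod>i=1..n. dunkl_weight m k i))"

context
  fixes m :: nat and k :: "nat \<Rightarrow> real"
  assumes m: "m > 0" and k: "\<And>j. j \<in> {1..m-1} \<Longrightarrow> k j \<ge> 0"
begin

lemma dunkl_weight_ge: "real n \<le> dunkl_weight m k n"
proof (cases "m dvd n")
  case False
  then have "n mod m \<in> {1..m-1}"
    using mod_less_divisor[OF m, of n] by (auto simp: dvd_eq_mod_eq_0)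
  then show ?thesis using k by (simp add: dunkl_weight_def)
qed (simp add: dunkl_weight_def)

lemma fact_le_prod_dunkl_weight: "fact n \<le> (\<Prod>i=1..n. dunkl_weight m k i)"
proof -
  have "fact n = (\<Prod>i=1..n. real i)" by (simp add: fact_prod)
  also have "\<dots> \<le> (\<Prod>i=1..n. dunkl_weight m k i)"
    using dunkl_weight_ge by (intro prod_mono) auto
  finally show ?thesis .
qed

lemma dunkl_exp_summable_norm:
  "summable (\<lambda>n. norm (z ^ n / complex_of_real (\<Prod>i=1..n. dunkl_weight m k i)))"
proof (rule summable_comparison_test'[OF summable_norm_exp[of z], of 0])
  fix n
  have "norm (z ^ n / complex_of_real (\<Prod>i=1..n. dunkl_weight m k i))
      = norm z ^ n / \<bar>\<Prod>i=1..n. dunkl_weight m k i\<bar>"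
    by (simp add: norm_divide norm_power flip: of_real_prod)
  also have "\<dots> \<le> norm z ^ n / fact n"
  proof (rule divide_left_mono)
    have "(0::real) < fact n" by simp
    with fact_le_prod_dunkl_weight[of n]
    show "fact n \<le> \<bar>\<Prod>i=1..n. dunkl_weight m k i\<bar>"
      by linarith
    with \<open>(0::real) < fact n\<close>
    show "0 < \<bar>\<Prod>i=1..n. dunkl_weight m k i\<bar> * fact n"
      by (intro mult_pos_pos) linarith+
  qed simp
  finally show "norm (norm (z ^ n / complex_of_real (\<Prod>i=1..n. dunkl_weight m k i)))
      \<le> norm (z ^ n /\<^sub>R fact n)"
    by (simp add: norm_power divide_inverse mult.commute)
qed

lemma dunkl_exp_sums:
  "(\<lambda>n. z ^ n / of_real (\<Prod>i=1..n. dunkl_weight m k i)) sums dunkl_exp m k z"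
  unfolding dunkl_exp_def
  by (rule summable_sums[OF summable_norm_cancel[OF dunkl_exp_summable_norm]])

lemma dunkl_exp_0: "dunkl_exp m k 0 = 1"
  using dunkl_exp_sums[of 0] powser_sums_zero[of "\<lambda>n. 1 / complex_of_real (\<Prod>i=1..n. dunkl_weight m k i)"]
  by (simp add: sums_iff)

lemma dunkl_exp_scaled_sums:
  "(\<lambda>n. c ^ n / of_real (\<Prod>i=1..n. dunkl_weight m k i) * y ^ n) sums dunkl_exp m k (c * y)"
  using dunkl_exp_sums[of "c * y"] by (simp add: power_mult_distrib)

lemma dunkl_exp_holomorphic: "(\<lambda>x. dunkl_exp m k (c * x)) holomorphic_on UNIV"
proof -
  have "(\<lambda>x. dunkl_exp m k (c * x))
      = (\<lambda>x. \<Sum>n. c ^ n / of_real (\<Prod>i=1..n. dunkl_weight m k i) * x ^ n)"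
    using dunkl_exp_scaled_sums by (auto simp: sums_iff)
  then show ?thesis
    using termdiffs_strong_converges_everywhere[OF sums_summable[OF dunkl_exp_scaled_sums[of c]]]
    unfolding holomorphic_on_def field_differentiable_def
    by (metis UNIV_I has_field_derivative_at_within)
qed

text \<open>
  The weight of \<open>x\<^sup>n\<^sup>+\<^sup>1\<close> cancels the last factor of its denominator and leaves \<open>c\<close> times the
  preceding term, while the constant term has weight \<open>0\<close>.
\<close>
lemma dunkl_formula_dunkl_exp:
  assumes "x \<in> rays m" "x \<noteq> 0"
  shows "dunkl_formula m k (\<lambda>x. dunkl_exp m k (c * x)) x = c * dunkl_exp m k (c * x)"
proof -
  define D where "D n = (\<Prod>i=1..n. dunkl_weight m k i)" for n
  let ?t = "\<lambda>n. complex_of_real (dunkl_weight m k n) * (c ^ n / of_real (D n)) * x ^ n"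
  have "?t sums (x * dunkl_formula m k (\<lambda>x. dunkl_exp m k (c * x)) x)"
    using dunkl_formula_power_series[OF m dunkl_exp_scaled_sums assms] by (simp add: D_def)
  moreover have "?t sums (c * x * dunkl_exp m k (c * x))"
  proof -
    have step: "?t (Suc n) = c * x * (c ^ n / of_real (D n) * x ^ n)" for n
    proof -
      have "dunkl_weight m k (Suc n) > 0" using dunkl_weight_ge[of "Suc n"] by simp
      moreover have "D (Suc n) = D n * dunkl_weight m k (Suc n)" by (simp add: D_def)
      ultimately show ?thesis by simp
    qed
    have "(\<lambda>n. c * x * (c ^ n / of_real (D n) * x ^ n)) sums (c * x * dunkl_exp m k (c * x))"
      unfolding D_def by (intro sums_mult dunkl_exp_scaled_sums)
    then have "(\<lambda>n. ?t (Suc n)) sums (c * x * dunkl_exp m k (c * x))"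
      by (simp only: step)
    then show ?thesis
      using sums_Suc_iff[of ?t "c * x * dunkl_exp m k (c * x)"] by (simp add: dunkl_weight_def)
  qed
  ultimately show ?thesis
    using assms(2) sums_unique2 by fastforce
qed

text \<open>At \<open>0\<close> the operator is a limit along the rays, found from the eigenvalue equation off \<open>0\<close> by continuity.\<close>
lemma complex_dunkl_dunkl_exp:
  assumes "x \<in> rays m"
  shows "complex_dunkl m k (\<lambda>x. dunkl_exp m k (c * x)) x = c * dunkl_exp m k (c * x)"
proof (cases "x = 0")
  case False
  then show ?thesis using assms by (simp add: complex_dunkl_def dunkl_formula_dunkl_exp)
next
  case True
  let ?g = "\<lambda>x. c * dunkl_exp m k (c * x)"
  have "continuous_on UNIV ?g"
    by (intro continuous_intros holomorphic_on_imp_continuous_on dunkl_exp_holomorphic)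
  then have "isCont ?g 0" by (simp add: continuous_on_eq_continuous_at)
  then have "(?g \<longlongrightarrow> ?g 0) (at 0 within rays m)"
    unfolding isCont_def by (rule tendsto_within_subset) simp
  then have "(dunkl_formula m k (\<lambda>x. dunkl_exp m k (c * x)) \<longlongrightarrow> ?g 0) (at 0 within rays m)"
    by (rule Lim_transform_within[where d = 1]) (simp_all add: dunkl_formula_dunkl_exp)
  then show ?thesis
    using True islimpt_rays[OF zero_in_rays[OF m]]
    by (simp add: complex_dunkl_def tendsto_Lim trivial_limit_within)
qed

end

section \<open>The Bessel combination\<close>

text \<open>
  The weights at \<open>n m + 1, \<dots>, n m + m - 1\<close> raise the order of the \<open>m - 1\<close> Pochhammer symbols
  one after the other, and the weight at \<open>(n + 1) m\<close> turns \<open>n!\<close> into \<open>(n + 1)!\<close>.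
\<close>
lemma prod_dunkl_weight:
  fixes \<nu> k :: "nat \<Rightarrow> real"
  assumes m: "m > 0"
    and rel: "\<And>j. j \<in> {1..m-1} \<Longrightarrow> real m * k j = real m * \<nu> j + real m - real j"
    and j: "j < m"
  shows "(\<Prod>i=1..n*m+j. dunkl_weight m k i) =
           real m ^ (n*m+j) * fact n * (\<Prod>i=1..m-1. pochhammer (\<nu> i + 1) n)
             * (\<Prod>i=1..j. \<nu> i + 1 + real n)"
proof -
  have weight: "dunkl_weight m k (n*m+i) = real m * (\<nu> i + 1 + real n)" if "i \<in> {1..m-1}" for n i
  proof -
    have "i < m" "i \<noteq> 0" using that by auto
    then have "(n*m+i) mod m = i" "\<not> m dvd n*m+i" by (simp_all add: dvd_eq_mod_eq_0)
    then show ?thesis using rel[OF that] by (simp add: dunkl_weight_def algebra_simps)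
  qed
  have inner: "(\<Prod>i=1..n*m+j. dunkl_weight m k i)
      = (\<Prod>i=1..n*m. dunkl_weight m k i) * real m ^ j * (\<Prod>i=1..j. \<nu> i + 1 + real n)"
    if "j < m" for n j
    using that
  proof (induction j)
    case (Suc j)
    then show ?case using weight[of "Suc j" n] by simp
  qed simp
  have outer: "(\<Prod>i=1..n*m. dunkl_weight m k i)
      = real m ^ (n*m) * fact n * (\<Prod>i=1..m-1. pochhammer (\<nu> i + 1) n)" for n
  proof (induction n)
    case (Suc n)
    have e: "Suc n * m = Suc (n * m + (m - 1))" using m by simp
    have "(\<Prod>i=1..Suc n * m. dunkl_weight m k i)
        = (\<Prod>i=1..n*m+(m-1). dunkl_weight m k i) * dunkl_weight m k (Suc n * m)"
      unfolding e by simp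
    also have "dunkl_weight m k (Suc n * m) = real (Suc n) * real m"
      unfolding dunkl_weight_def by (simp add: algebra_simps)
    also have "(\<Prod>i=1..n*m+(m-1). dunkl_weight m k i) = real m ^ (n*m) * fact n *
        (\<Prod>i=1..m-1. pochhammer (\<nu> i + 1) n) * real m ^ (m-1) * (\<Prod>i=1..m-1. \<nu> i + 1 + real n)"
      using inner[of "m - 1" n] m by (simp only: Suc.IH)
    \<comment> \<open>The factors are paired with their counterparts at \<open>n + 1\<close>.\<close>
    also have "\<dots> * (real (Suc n) * real m) = (real m ^ (n*m) * (real m ^ (m-1) * real m)) *
        (real (Suc n) * fact n) *
        ((\<Prod>i=1..m-1. pochhammer (\<nu> i + 1) n) * (\<Prod>i=1..m-1. \<nu> i + 1 + real n))"
      by (simp only: mult_ac)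
    also have "real m ^ (n*m) * (real m ^ (m-1) * real m) = real m ^ (Suc n * m)"
      unfolding e by (simp add: power_add mult_ac)
    also have "real (Suc n) * fact n = fact (Suc n)" by simp
    also have "(\<Prod>i=1..m-1. pochhammer (\<nu> i + 1) n) * (\<Prod>i=1..m-1. \<nu> i + 1 + real n)
        = (\<Prod>i=1..m-1. pochhammer (\<nu> i + 1) (Suc n))"
      by (simp add: prod.distrib[symmetric] pochhammer_Suc)
    finally show ?case .
  qed simp
  show ?thesis unfolding inner[OF j] outer power_add by (simp only: mult_ac)
qed

text \<open>
  For \<open>i \<le> j\<close> both sides contain the Pochhammer symbol of \<open>\<nu>\<^sub>i + 1\<close> of order \<open>n + 1\<close>, split off at
  its first factor on the left, which leaves the symbol of the shifted index, and at its last
  factor on the right.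
\<close>
lemma prod_pochhammer_raise_first:
  fixes \<nu> :: "nat \<Rightarrow> real"
  assumes "j < m"
  shows "(\<Prod>i=1..j. \<nu> i + 1) * (\<Prod>i=1..m-1. pochhammer (raise_first j \<nu> i + 1) n)
       = (\<Prod>i=1..m-1. pochhammer (\<nu> i + 1) n) * (\<Prod>i=1..j. \<nu> i + 1 + real n)"
proof -
  have pad: "(\<Prod>i=1..j. g i) = (\<Prod>i=1..m-1. if i \<le> j then g i else 1)" for g :: "nat \<Rightarrow> real"
    using assms by (intro prod.mono_neutral_cong_left) auto
  have "(\<nu> i + 1) * pochhammer (\<nu> i + 1 + 1) n = pochhammer (\<nu> i + 1) n * (\<nu> i + 1 + real n)" for i
    by (metis pochhammer_rec pochhammer_Suc)
  then show ?thesis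
    unfolding pad prod.distrib[symmetric]
    by (intro prod.cong refl) (simp add: raise_first_def)
qed

lemma dunkl_kappa_power_m: "m > 0 \<Longrightarrow> dunkl_kappa m ^ m = -1"
  by (simp add: dunkl_kappa_def exp_of_nat_mult[symmetric])

definition hyper_bessel_term :: "nat \<Rightarrow> (nat \<Rightarrow> real) \<Rightarrow> complex \<Rightarrow> nat \<Rightarrow> complex" where
  "hyper_bessel_term m \<mu> x n =
     of_real ((-1) ^ n * (\<Prod>j=1..m-1. Gamma (\<mu> j + 1)) /
                 (fact n * (\<Prod>j=1..m-1. Gamma (\<mu> j + real n + 1)))) *
          (x / of_nat m) ^ (n * m)"

lemma hyper_bessel_eq: "hyper_bessel m \<mu> x = (\<Sum>n. hyper_bessel_term m \<mu> x n)"
  by (simp add: hyper_bessel_def hyper_bessel_term_def)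

text \<open>Positivity keeps the arguments of Gamma away from its poles, where the quotient is a junk value.\<close>
lemma hyper_bessel_term_pochhammer:
  assumes "\<And>i. i \<in> {1..m-1} \<Longrightarrow> \<mu> i + 1 > 0"
  shows "hyper_bessel_term m \<mu> x n =
    (-1) ^ n / of_real (fact n * (\<Prod>i=1..m-1. pochhammer (\<mu> i + 1) n)) * (x / of_nat m) ^ (n * m)"
proof -
  have "Gamma (\<mu> i + 1) / Gamma (\<mu> i + real n + 1) = inverse (pochhammer (\<mu> i + 1) n)"
    if "i \<in> {1..m-1}" for i
  proof -
    have "\<mu> i + 1 \<notin> \<int>\<^sub>\<le>\<^sub>0" using assms[OF that] by (auto elim!: nonpos_Ints_cases)
    then show ?thesis by (simp add: pochhammer_Gamma add_ac)
  qed
  then have "(\<Prod>i=1..m-1. Gamma (\<mu> i + 1)) / (\<Prod>i=1..m-1. Gamma (\<mu> i + real n + 1))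
      = inverse (\<Prod>i=1..m-1. pochhammer (\<mu> i + 1) n)"
    by (simp add: prod_dividef[symmetric] prod_inversef[symmetric])
  then have "(-1) ^ n / fact n * ((\<Prod>i=1..m-1. Gamma (\<mu> i + 1)) / (\<Prod>i=1..m-1. Gamma (\<mu> i + real n + 1)))
      = (-1) ^ n / fact n * inverse (\<Prod>i=1..m-1. pochhammer (\<mu> i + 1) n)"
    by (rule arg_cong)
  then have "(-1) ^ n * (\<Prod>i=1..m-1. Gamma (\<mu> i + 1)) / (fact n * (\<Prod>i=1..m-1. Gamma (\<mu> i + real n + 1)))
      = (-1) ^ n / (fact n * (\<Prod>i=1..m-1. pochhammer (\<mu> i + 1) n))"
    by (simp only: times_divide_times_eq divide_inverse[symmetric] divide_divide_eq_left)
  then show ?thesis unfolding hyper_bessel_term_def by (simp only: of_real_divide of_real_power of_real_minus of_real_1)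
qed

text \<open>
  The term with exponent \<open>n m + j\<close> of \<open>E (\<kappa> y)\<close> is the \<open>n\<close>-th term of the \<open>j\<close>-th Bessel function:
  the signs come from \<open>\<kappa>\<^sup>n\<^sup>m = (-1)\<^sup>n\<close>, and the first factors \<open>\<nu>\<^sub>i + 1\<close> with \<open>i \<le> j\<close> form the
  denominator in front.
\<close>
lemma dunkl_exp_term_eq:
  fixes \<nu> k :: "nat \<Rightarrow> real"
  assumes m: "m > 0"
    and rel: "\<And>j. j \<in> {1..m-1} \<Longrightarrow> real m * k j = real m * \<nu> j + real m - real j"
    and pos: "\<And>i. i \<in> {1..m-1} \<Longrightarrow> \<nu> i + 1 > 0"
    and j: "j < m"
  shows "(dunkl_kappa m * y) ^ (n*m+j) / of_real (\<Prod>i=1..n*m+j. dunkl_weight m k i)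
    = (dunkl_kappa m * y) ^ j / (of_nat m ^ j * (\<Prod>i=1..j. of_real (\<nu> i + 1))) *
        hyper_bessel_term m (raise_first j \<nu>) y n"
proof -
  define A where "A = complex_of_real (\<Prod>i=1..j. \<nu> i + 1)"
  define P where "P = complex_of_real (\<Prod>i=1..m-1. pochhammer (raise_first j \<nu> i + 1) n)"
  have "(\<Prod>i=1..n*m+j. dunkl_weight m k i) = real m ^ (n*m+j) * fact n *
      ((\<Prod>i=1..j. \<nu> i + 1) * (\<Prod>i=1..m-1. pochhammer (raise_first j \<nu> i + 1) n))"
    using prod_dunkl_weight[where \<nu> = \<nu> and n = n, OF m rel j]
    by (simp only: prod_pochhammer_raise_first[OF j] mult_ac)
  then have D: "complex_of_real (\<Prod>i=1..n*m+j. dunkl_weight m k i)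
      = of_nat m ^ (n*m) * of_nat m ^ j * fact n * (A * P)"
    by (simp add: A_def P_def power_add)
  have "raise_first j \<nu> i + 1 > 0" if "i \<in> {1..m-1}" for i
    using pos[OF that] by (simp add: raise_first_def)
  then have H: "hyper_bessel_term m (raise_first j \<nu>) y n
      = (-1) ^ n / (fact n * P) * (y / of_nat m) ^ (n * m)"
    by (subst hyper_bessel_term_pochhammer) (auto simp: P_def)
  have "dunkl_kappa m ^ (n * m) = (-1) ^ n"
    using dunkl_kappa_power_m[OF m] by (metis mult.commute power_mult)
  then have K: "(dunkl_kappa m * y) ^ (n*m+j) = (-1) ^ n * y ^ (n * m) * (dunkl_kappa m * y) ^ j"
    by (simp add: power_add power_mult_distrib)
  have A: "(\<Prod>i=1..j. of_real (\<nu> i + 1)) = A" by (simp add: A_def)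
  show ?thesis unfolding D H K A by (simp add: power_divide mult_ac)
qed

text \<open>
  The series of \<open>E (\<kappa> y)\<close>, regrouped into blocks of \<open>m\<close> consecutive terms, is a sum of \<open>m\<close> series;
  absolute convergence makes each of them convergent.
\<close>
lemma dunkl_exp_eq_hyper_bessel_sum:
  fixes \<nu> k :: "nat \<Rightarrow> real"
  assumes m: "m > 0"
    and rel: "\<And>j. j \<in> {1..m-1} \<Longrightarrow> real m * k j = real m * \<nu> j + real m - real j"
    and k: "\<And>j. j \<in> {1..m-1} \<Longrightarrow> k j \<ge> 0"
  shows "dunkl_exp m k (dunkl_kappa m * y) =
    (\<Sum>j<m. (dunkl_kappa m * y) ^ j / (of_nat m ^ j * (\<Prod>i=1..j. of_real (\<nu> i + 1))) *
        hyper_bessel m (raise_first j \<nu>) y)"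
proof -
  define t where "t n = (dunkl_kappa m * y) ^ n / of_real (\<Prod>i=1..n. dunkl_weight m k i)" for n
  define C where "C j = (dunkl_kappa m * y) ^ j / (of_nat m ^ j * (\<Prod>i=1..j. of_real (\<nu> i + 1)))" for j
  \<comment> \<open>\<open>m (\<nu> i + 1) = m k i + i\<close>\<close>
  have pos: "\<nu> i + 1 > 0" if "i \<in> {1..m-1}" for i
  proof -
    have "real m * k i \<ge> 0" using k[OF that] by simp
    then have "real m * (\<nu> i + 1) > 0"
      using rel[OF that] that by (simp add: algebra_simps)
    then show ?thesis using m by (simp add: zero_less_mult_iff)
  qed
  have t: "t (n*m+j) = C j * hyper_bessel_term m (raise_first j \<nu>) y n" if "j < m" for n j
    unfolding t_def C_def using m rel pos that by (rule dunkl_exp_term_eq)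
  have summ: "summable (\<lambda>n. t (n*m+j))" for j
  proof -
    have "summable ((\<lambda>n. norm (t n)) \<circ> (\<lambda>n. n*m+j))"
    proof (rule summable_reindex)
      show "summable (\<lambda>n. norm (t n))"
        unfolding t_def by (rule dunkl_exp_summable_norm[OF m k])
      show "inj (\<lambda>n. n*m+j)" using m by (auto simp: inj_on_def)
    qed simp
    then show ?thesis unfolding o_def by (rule summable_norm_cancel)
  qed
  \<comment> \<open>The Bessel series inherits convergence from \<open>t\<close> only where its coefficient is nonzero.\<close>
  have sums: "(\<lambda>n. t (n*m+j)) sums (C j * hyper_bessel m (raise_first j \<nu>) y)" if "j < m" for j
  proof (cases "C j = 0")
    case True
    then show ?thesis using t[OF that] by simp
  next
    case False
    then have "summable (hyper_bessel_term m (raise_first j \<nu>) y)"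
      using summ[of j] t[OF that] by (simp add: summable_cmult_iff)
    then show ?thesis
      unfolding t[OF that] hyper_bessel_eq by (intro sums_mult summable_sums)
  qed
  have "(\<lambda>n. \<Sum>j<m. t (n*m+j)) sums (\<Sum>j<m. C j * hyper_bessel m (raise_first j \<nu>) y)"
    by (intro sums_sum sums) simp
  moreover have "(\<lambda>n. \<Sum>j<m. t (n*m+j)) sums dunkl_exp m k (dunkl_kappa m * y)"
  proof -
    have "t sums dunkl_exp m k (dunkl_kappa m * y)"
      unfolding t_def by (rule dunkl_exp_sums[OF m k])
    moreover have "sum t {n*m..<n*m+m} = (\<Sum>j<m. t (n*m+j))" for n
      using sum.shift_bounds_nat_ivl[of t 0 "n*m" m]
      by (simp add: atLeast0LessThan add.commute)
    ultimately show ?thesis using sums_group[of t _ m] m by simp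
  qed
  ultimately show ?thesis unfolding C_def by (rule sums_unique2[symmetric])
qed

lemma dunkl_kernel_eq_dunkl_exp:
  fixes \<nu> k :: "nat \<Rightarrow> real"
  assumes m: "m > 0"
    and rel: "\<And>j. j \<in> {1..m-1} \<Longrightarrow> real m * k j = real m * \<nu> j + real m - real j"
    and k: "\<And>j. j \<in> {1..m-1} \<Longrightarrow> k j \<ge> 0"
  shows "dunkl_kernel m \<nu> lam = (\<lambda>x. dunkl_exp m k (dunkl_kappa m * lam * x))"
proof
  fix x
  have expansion: "dunkl_exp m k (dunkl_kappa m * (lam * x)) =
      (\<Sum>j<m. (dunkl_kappa m * (lam * x)) ^ j / (of_nat m ^ j * (\<Prod>i=1..j. of_real (\<nu> i + 1))) *
        hyper_bessel m (raise_first j \<nu>) (lam * x))"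
    by (rule dunkl_exp_eq_hyper_bessel_sum[OF m rel k])
  have "hyper_bessel m (raise_first 0 \<nu>) (lam * x) = hyper_bessel m \<nu> (lam * x)"
    by (simp add: hyper_bessel_def raise_first_def)
  moreover have "{..<m} = insert 0 {1..m-1}" using m by auto
  ultimately show "dunkl_kernel m \<nu> lam x = dunkl_exp m k (dunkl_kappa m * lam * x)"
    using expansion
    by (simp add: dunkl_kernel_def mult.assoc)
qed

theorem theorem4p2:
  fixes m :: nat and lam :: complex and \<nu> k :: "nat \<Rightarrow> real"
  assumes "m \<ge> 2"
    and "\<And>j. j \<in> {1..m-1} \<Longrightarrow> real m * k j = real m * \<nu> j + real m - real j"
    and "\<And>j. j \<in> {1..m-1} \<Longrightarrow> k j \<ge> 0"
  shows "smooth_on_rays m (dunkl_kernel m \<nu> lam) \<and>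
         (\<forall>x\<in>rays m. complex_dunkl m k (dunkl_kernel m \<nu> lam) x
                        = dunkl_kappa m * lam * dunkl_kernel m \<nu> lam x) \<and>
         dunkl_kernel m \<nu> lam 0 = 1"
proof -
  have m: "m > 0" using assms(1) by simp
  have kernel: "dunkl_kernel m \<nu> lam = (\<lambda>x. dunkl_exp m k (dunkl_kappa m * lam * x))"
    by (rule dunkl_kernel_eq_dunkl_exp[OF m assms(2,3)])
  show ?thesis
    unfolding kernel
    using smooth_on_rays_holomorphic[OF dunkl_exp_holomorphic[OF m assms(3)]]
      complex_dunkl_dunkl_exp[OF m assms(3)] dunkl_exp_0[OF m assms(3)]
    by simp
qed

end
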